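(* Let $K$ be an algebraically closed field and $A$ a finite-dimensional gr-division superalgebra over $K$. Then $A$ is (up to isomorphism of superalgebras) either $K$ with trivial grading, or the superalgebra $D$ with $D_{\bar0}=K$, $D_{\bar1}=K\varepsilon$ and $\varepsilon^2=1$.
   Context: A superalgebra is a $\mathbb Z_2$-graded associative unital $K$-algebra $A=A_{\bar0}\oplus A_{\bar1}$ with $A_gA_h\subseteq A_{g+h}$, $\mathbb Z_2=\mathbb Z/2\mathbb Z$. It is trivially graded if $A=A_{\bar0}$. A gr-division superalgebra is a (nonzero) superalgebra in which every nonzero homogeneous element is invertible. In $D$, $\varepsilon$ is a nonzero element and $D_{\bar1}$ is one-dimensional. *)

theory Defs
  imports "HOL-Library.Z2" "HOL-Computational_Algebra.Polynomial"
begin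

(* The grading group Z/2Z is the type bit; a grading is the family of its two components.
   Class ring_1 (associative, unital, not necessarily commutative) includes 0 \<noteq> 1, so the
   zero algebra is excluded here, as it is among gr-division superalgebras. *)
locale superalgebra = vector_space scale
  for scale :: "'k::field \<Rightarrow> 'a::ring_1 \<Rightarrow> 'a" (infixr \<open>*s\<close> 75) +
  fixes gr :: "bit \<Rightarrow> 'a set"
  assumes mult_scale_left: "(c *s x) * y = c *s (x * y)"
    and mult_scale_right: "x * (c *s y) = c *s (x * y)"
    and subspace_gr: "subspace (gr g)"
    and gr_sum: "\<exists>x0\<in>gr 0. \<exists>x1\<in>gr 1. x = x0 + x1"
    and gr_direct: "gr 0 \<inter> gr 1 = {0}"
    and gr_mult: "x \<in> gr g \<Longrightarrow> y \<in> gr h \<Longrightarrow> x * y \<in> gr (g + h)"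

locale gr_division_superalgebra = superalgebra +
  assumes homogeneous_invertible:
    "x \<in> gr g \<Longrightarrow> x \<noteq> 0 \<Longrightarrow> \<exists>y. x * y = 1 \<and> y * x = 1"

definition superalgebra_iso ::
  "('k::field \<Rightarrow> 'a::ring_1 \<Rightarrow> 'a) \<Rightarrow> (bit \<Rightarrow> 'a set) \<Rightarrow>
   ('k \<Rightarrow> 'b::ring_1 \<Rightarrow> 'b) \<Rightarrow> (bit \<Rightarrow> 'b set) \<Rightarrow> ('a \<Rightarrow> 'b) \<Rightarrow> bool"
  where "superalgebra_iso s A t B f \<longleftrightarrow>
    Vector_Spaces.linear s t f \<and> bij f \<and> f 1 = 1 \<and>
    (\<forall>x y. f (x * y) = f x * f y) \<and> (\<forall>g. f ` A g = B g)"

definition superalgebra_isomorphic ::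
  "('k::field \<Rightarrow> 'a::ring_1 \<Rightarrow> 'a) \<Rightarrow> (bit \<Rightarrow> 'a set) \<Rightarrow>
   ('k \<Rightarrow> 'b::ring_1 \<Rightarrow> 'b) \<Rightarrow> (bit \<Rightarrow> 'b set) \<Rightarrow> bool"
  where "superalgebra_isomorphic s A t B \<longleftrightarrow> (\<exists>f. superalgebra_iso s A t B f)"

definition trivial_grading :: "bit \<Rightarrow> 'a::zero set"
  where "trivial_grading g = (if g = 0 then UNIV else {0})"

(* SuperD a b stands for a + b \<epsilon>, where \<epsilon>\<^sup>2 = 1 and \<epsilon> commutes with the scalars. *)
datatype 'k superD = SuperD (D_scalar: 'k) (D_coeff: 'k)

instantiation superD :: (field) ring_1
begin

definition zero_superD :: "'a superD" where "0 = SuperD 0 0"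
definition one_superD :: "'a superD" where "1 = SuperD 1 0"
definition plus_superD :: "'a superD \<Rightarrow> 'a superD \<Rightarrow> 'a superD"
  where "x + y = SuperD (D_scalar x + D_scalar y) (D_coeff x + D_coeff y)"
definition uminus_superD :: "'a superD \<Rightarrow> 'a superD"
  where "- x = SuperD (- D_scalar x) (- D_coeff x)"
definition minus_superD :: "'a superD \<Rightarrow> 'a superD \<Rightarrow> 'a superD"
  where "x - y = SuperD (D_scalar x - D_scalar y) (D_coeff x - D_coeff y)"
definition times_superD :: "'a superD \<Rightarrow> 'a superD \<Rightarrow> 'a superD"
  where "x * y = SuperD (D_scalar x * D_scalar y + D_coeff x * D_coeff y)
                        (D_scalar x * D_coeff y + D_coeff x * D_scalar y)"

lemmas superD_ops = zero_superD_def one_superD_def plus_superD_def uminus_superD_def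
  minus_superD_def times_superD_def

instance
  by standard (auto simp: superD_ops algebra_simps)

end

definition scaleD :: "'k::field \<Rightarrow> 'k superD \<Rightarrow> 'k superD"
  where "scaleD c x = SuperD (c * D_scalar x) (c * D_coeff x)"

definition epsD :: "'k::field superD"
  where "epsD = SuperD 0 1"

definition gradingD :: "bit \<Rightarrow> 'k::field superD set"
  where "gradingD g = (if g = 0 then range (\<lambda>c. scaleD c 1) else range (\<lambda>c. scaleD c epsD))"

lemma epsD_square: "epsD * epsD = (1 :: 'k::field superD)"
  by (simp add: epsD_def superD_ops)

lemma epsD_nonzero: "epsD \<noteq> (0 :: 'k::field superD)"
  by (simp add: epsD_def superD_ops)

lemma gradingD_0: "gradingD 0 = {SuperD a 0 | a. True}"
  and gradingD_1: "gradingD 1 = {SuperD 0 b | b. True}"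
  by (auto simp: gradingD_def scaleD_def epsD_def superD_ops)

lemma gr_division_superalgebra_trivial:
  "gr_division_superalgebra ((*) :: 'k::field \<Rightarrow> 'k \<Rightarrow> 'k) trivial_grading"
proof -
  interpret vector_space "(*) :: 'k \<Rightarrow> 'k \<Rightarrow> 'k"
    by standard (simp_all add: algebra_simps)
  show ?thesis
  proof
    fix x :: 'k and g
    show "\<exists>y. x * y = 1 \<and> y * x = 1" if "x \<noteq> 0"
      using that by (intro exI[of _ "inverse x"]) simp
  qed (auto simp: trivial_grading_def subspace_def split: if_splits)
qed

lemma gr_division_superalgebra_D:
  "gr_division_superalgebra (scaleD :: 'k::field \<Rightarrow> _) gradingD"
proof -
  interpret vector_space "scaleD :: 'k \<Rightarrow> _"
    by standard (simp_all add: scaleD_def superD_ops algebra_simps)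
  show ?thesis
  proof
    fix g h :: bit and x y :: "'k superD" and c :: 'k
    show "scaleD c x * y = scaleD c (x * y)" "x * scaleD c y = scaleD c (x * y)"
      by (simp_all add: scaleD_def superD_ops algebra_simps)
    show "subspace (gradingD g)"
      by (cases g) (auto simp: subspace_def gradingD_0 gradingD_1 scaleD_def superD_ops)
    show "\<exists>x0\<in>gradingD 0. \<exists>x1\<in>gradingD 1. x = x0 + x1"
      by (intro bexI[of _ "SuperD (D_scalar x) 0"] bexI[of _ "SuperD 0 (D_coeff x)"])
        (auto simp: gradingD_0 gradingD_1 superD_ops)
    show "gradingD 0 \<inter> gradingD 1 = {0 :: 'k superD}"
      by (auto simp: gradingD_0 gradingD_1 superD_ops)
    show "x * y \<in> gradingD (g + h)" if "x \<in> gradingD g" "y \<in> gradingD h"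
      using that by (cases g; cases h) (auto simp: gradingD_0 gradingD_1 superD_ops)
    show "\<exists>y. x * y = 1 \<and> y * x = 1" if "x \<in> gradingD g" "x \<noteq> 0"
    proof (cases "g = 0")
      case True
      with that obtain a where "x = SuperD a 0" "a \<noteq> 0"
        by (auto simp: gradingD_0 superD_ops)
      then show ?thesis
        by (intro exI[of _ "SuperD (inverse a) 0"]) (simp add: superD_ops)
    next
      case False
      with that obtain b where "x = SuperD 0 b" "b \<noteq> 0"
        by (auto simp: gradingD_1 superD_ops)
      then show ?thesis
        by (intro exI[of _ "SuperD 0 (inverse b)"]) (simp add: superD_ops)
    qed
  qed
qed

end

theory Submission
  imports Defs
begin

text \<open>
  The even part of a gr-division superalgebra is a division algebra. Finite dimension makes the
  powers of an even element \<open>x\<close> linearly dependent, so \<open>x\<close> satisfies a nonzero polynomial; over an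
  algebraically closed field this polynomial splits into linear factors, and since no nonzero
  even element is a zero divisor, one of the factors \<open>x - c\<close> must vanish. Thus the even part
  consists of the scalars (\<open>even_part_eq_scalars\<close>).

  If the odd part is zero, the algebra is the field itself. Otherwise take a nonzero odd \<open>u\<close>. Its
  square is even, hence a scalar, and this scalar is nonzero because \<open>u\<close> is invertible. Dividing
  \<open>u\<close> by a square root of it gives an odd \<open>e\<close> with \<open>e * e = 1\<close> (\<open>odd_involution_exists\<close>). Left
  multiplication by \<open>e\<close> exchanges the two parts, so the odd part is the line through \<open>e\<close>
  (\<open>odd_part_eq_multiples\<close>), and sending \<open>\<epsilon>\<close> to \<open>e\<close> is the required isomorphism.
\<close>

section \<open>Inverse isomorphisms and the unit\<close>

text \<open>
  The maps below are most easily written from the concrete algebras into the abstract one; this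
  lemma turns them around.
\<close>
lemma superalgebra_iso_inv:
  assumes "superalgebra_iso s A t B f"
  shows "superalgebra_iso t B s A (inv f)"
proof -
  have lin: "Vector_Spaces.linear s t f" and bij: "bij f" and one: "f 1 = 1"
    and mult: "\<And>x y. f (x * y) = f x * f y" and gr: "\<And>g. f ` A g = B g"
    using assms by (auto simp: superalgebra_iso_def)
  interpret Vector_Spaces.linear s t f by (fact lin)
  have f_inv: "f (inv f y) = y" for y
    using bij by (simp add: bij_is_surj surj_f_inv_f)
  have inv_eqI: "inv f y = x" if "f x = y" for x y
    using bij that by (auto simp: bij_is_inj)
  have "Vector_Spaces.linear t s (inv f)"
    by unfold_locales (auto intro!: inv_eqI simp: add scale f_inv)
  moreover have "inv f ` B g = A g" for g
    using bij by (simp flip: gr add: image_image bij_is_inj)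
  ultimately show ?thesis
    using bij by (auto simp: superalgebra_iso_def bij_imp_bij_inv f_inv one mult intro!: inv_eqI)
qed

context superalgebra
begin

lemma gr_direct_eq_0: "x \<in> gr 0 \<Longrightarrow> x \<in> gr 1 \<Longrightarrow> x = 0"
  using gr_direct by auto

text \<open>
  Write \<open>1 = e + o'\<close> with \<open>e\<close> even and \<open>o'\<close> odd. Multiplying by \<open>e\<close> and by \<open>o'\<close> and comparing
  components of equal degree forces first \<open>e * o' = 0\<close> and then \<open>o' = o' * o' = 0\<close>.
\<close>
lemma one_in_gr_0: "1 \<in> gr 0"
proof -
  obtain e o' where e: "e \<in> gr 0" and o': "o' \<in> gr 1" and sum: "1 = e + o'"
    using gr_sum[of 1] by auto
  have prod: "e * o' \<in> gr 1" "o' * o' \<in> gr 0"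
    using gr_mult[OF e o'] gr_mult[OF o' o'] by auto
  have "e * o' = e - e * e"
    using arg_cong[OF sum, of "\<lambda>z. e * z"] by (simp add: algebra_simps)
  moreover have "e - e * e \<in> gr 0"
    using gr_mult[OF e e] e by (auto intro: subspace_diff subspace_gr)
  ultimately have "e * o' = 0"
    using prod(1) gr_direct_eq_0 by metis
  moreover have "o' = e * o' + o' * o'"
    using arg_cong[OF sum, of "\<lambda>z. z * o'"] by (simp add: algebra_simps)
  ultimately have "o' = o' * o'" by simp
  then have "o' = 0"
    using prod(2) o' gr_direct_eq_0 by metis
  with sum e show ?thesis by simp
qed

lemma scale_one_in_gr_0: "c *s 1 \<in> gr 0"
  by (intro subspace_scale subspace_gr one_in_gr_0)

section \<open>Polynomials evaluated in the algebra\<close>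

text \<open>
  The constant \<open>poly\<close> evaluates at elements of the coefficient ring, which is commutative; here a
  polynomial over the ground field is evaluated at an element of the algebra.
\<close>
definition poly_at :: "'a \<Rightarrow> 'k poly \<Rightarrow> 'a"
  where "poly_at x p = (\<Sum>i\<le>degree p. coeff p i *s x ^ i)"

lemma poly_at_bound: "degree p \<le> n \<Longrightarrow> poly_at x p = (\<Sum>i\<le>n. coeff p i *s x ^ i)"
  unfolding poly_at_def by (intro sum.mono_neutral_left) (auto simp: coeff_eq_0)

text \<open>
  Evaluation at \<open>x\<close> turns the product with a linear factor into a product in the algebra, so that
  invertibility of \<open>x - c\<close> can be used to cancel that factor.
\<close>
lemma poly_at_linear_factor_mult: "poly_at x ([:-c, 1:] * q) = (x - c *s 1) * poly_at x q"
proof -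
  have "[:-c, 1:] * q = pCons 0 q - smult c q"
    by (simp add: algebra_simps)
  moreover have "degree (pCons 0 q - smult c q) \<le> Suc (degree q)"
    by (intro degree_diff_le) (auto intro: order.trans[OF degree_smult_le] simp: degree_pCons_le)
  ultimately have "poly_at x ([:-c, 1:] * q) =
      (\<Sum>i\<le>Suc (degree q). coeff (pCons 0 q) i *s x ^ i)
      - (\<Sum>i\<le>Suc (degree q). c *s (coeff q i *s x ^ i))"
    by (simp only: poly_at_bound flip: sum_subtractf) (simp add: scale_left_diff_distrib)
  also have "(\<Sum>i\<le>Suc (degree q). coeff (pCons 0 q) i *s x ^ i) = x * poly_at x q"
    by (subst sum.atMost_Suc_shift)
      (simp add: poly_at_def sum_distrib_left mult_scale_right)
  also have "(\<Sum>i\<le>Suc (degree q). c *s (coeff q i *s x ^ i)) = c *s poly_at x q"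
    by (simp only: poly_at_bound[of q "Suc (degree q)"] scale_sum_right le_SucI order.refl)
  finally show ?thesis
    by (simp add: left_diff_distrib mult_scale_left)
qed

text \<open>
  The powers of \<open>x\<close> either repeat, which makes a difference of two monomials vanish at \<open>x\<close>, or
  form an infinite set, which a finite dimension makes linearly dependent.
\<close>
lemma poly_at_eq_0_exists:
  assumes "finite_dimensional_vector_space (*s) Basis"
  shows "\<exists>p. p \<noteq> 0 \<and> poly_at x p = 0"
proof -
  interpret fd: finite_dimensional_vector_space "(*s)" Basis by (fact assms)
  show ?thesis
  proof (cases "inj (\<lambda>i. x ^ i)")
    case True
    then have "infinite (range (\<lambda>i. x ^ i))"
      by (simp add: finite_image_iff)
    then have "dependent (range (\<lambda>i. x ^ i))"
      using fd.finiteI_independent by blast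
    then obtain t u where t: "finite t" "t \<subseteq> range (\<lambda>i. x ^ i)"
      and u: "(\<Sum>v\<in>t. u v *s v) = 0" "\<exists>v\<in>t. u v \<noteq> 0"
      by (auto simp: dependent_explicit)
    then obtain I where I: "finite I" "t = (\<lambda>i. x ^ i) ` I"
      using finite_subset_image by metis
    define p where "p = (\<Sum>i\<in>I. monom (u (x ^ i)) i)"
    have coeff: "coeff p i = (if i \<in> I then u (x ^ i) else 0)" for i
      using I(1) by (simp add: p_def coeff_sum if_distrib)
    have "p \<noteq> 0"
      using u(2) I(2) coeff by (metis coeff_0 imageE)
    moreover have "poly_at x p = (\<Sum>i\<in>I. u (x ^ i) *s x ^ i)"
      unfolding poly_at_def
      by (rule sum.mono_neutral_cong) (auto simp: coeff I(1) intro!: le_degree split: if_splits)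
    moreover have "\<dots> = 0"
      using u(1) True unfolding I(2) by (subst (asm) sum.reindex) (auto intro: inj_on_subset)
    ultimately show ?thesis by auto
  next
    case False
    then obtain i j where ij: "x ^ i = x ^ j" "i < j"
      unfolding inj_on_def by (metis linorder_neqE_nat)
    let ?p = "monom 1 i - monom 1 j :: 'k poly"
    have "coeff ?p j \<noteq> 0" using ij(2) by simp
    then have "?p \<noteq> 0" by (metis coeff_0)
    moreover have "degree ?p \<le> j"
      using ij(2) by (intro degree_diff_le) (auto simp: degree_monom_eq)
    then have "poly_at x ?p =
        (\<Sum>k\<le>j. coeff (monom 1 i) k *s x ^ k) - (\<Sum>k\<le>j. coeff (monom 1 j) k *s x ^ k)"
      by (simp only: poly_at_bound flip: sum_subtractf) (simp add: scale_left_diff_distrib)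
    then have "poly_at x ?p = 0"
      using ij by (simp add: if_distrib[of "\<lambda>c. c *s _"] cong: if_cong)
    ultimately show ?thesis by blast
  qed
qed

end

section \<open>The two homogeneous components\<close>

lemma (in gr_division_superalgebra) homogeneous_mult_eq_0:
  assumes "x \<in> gr g" "x \<noteq> 0" "x * z = 0"
  shows "z = 0"
proof -
  obtain y where "y * x = 1"
    using homogeneous_invertible assms by blast
  then show ?thesis
    using assms(3) by (metis mult.assoc mult_1 mult_zero_right)
qed

locale alg_closed_gr_division_superalgebra = gr_division_superalgebra scale gr
  for scale :: "'k::alg_closed_field \<Rightarrow> 'a::ring_1 \<Rightarrow> 'a" (infixr \<open>*s\<close> 75) and gr
begin

text \<open>
  Induction on the degree of the annihilating polynomial: split off a root \<open>c\<close>. If \<open>x\<close> is not the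
  scalar \<open>c\<close>, then \<open>x - c\<close> is even and invertible, so the cofactor already annihilates \<open>x\<close>. The
  descent must stop, as a nonzero constant does not annihilate \<open>x\<close>.
\<close>
lemma even_algebraic_imp_scalar:
  assumes "x \<in> gr 0" "p \<noteq> 0" "poly_at x p = 0"
  shows "\<exists>c. x = c *s 1"
  using assms(2,3)
proof (induction "degree p" arbitrary: p rule: less_induct)
  case less
  have "degree p \<noteq> 0"
  proof
    assume "degree p = 0"
    then show False
      using less.prems by (auto simp: poly_at_def elim!: degree_eq_zeroE)
  qed
  then obtain c where "poly p c = 0"
    using alg_closed_imp_poly_has_root by blast
  then obtain q where q: "p = [:-c, 1:] * q"
    by (auto simp: poly_eq_0_iff_dvd)
  show ?case
  proof (cases "x = c *s 1")
    case False
    have "x - c *s 1 \<in> gr 0"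
      by (intro subspace_diff subspace_gr assms(1) scale_one_in_gr_0)
    moreover have "(x - c *s 1) * poly_at x q = 0"
      using less.prems(2) unfolding q poly_at_linear_factor_mult .
    ultimately have "poly_at x q = 0"
      using False homogeneous_mult_eq_0 by auto
    moreover have "q \<noteq> 0" using less.prems(1) q by auto
    moreover have "degree q < degree p"
      unfolding q using \<open>q \<noteq> 0\<close> by (subst degree_mult_eq) auto
    ultimately show ?thesis using less.hyps by blast
  qed blast
qed

lemma even_part_eq_scalars:
  assumes "finite_dimensional_vector_space (*s) Basis"
  shows "gr 0 = range (\<lambda>c. c *s 1)"
  using even_algebraic_imp_scalar poly_at_eq_0_exists[OF assms] scale_one_in_gr_0 by blast

text \<open>
  A nonzero odd \<open>u\<close> has \<open>u * u = c\<close> with a scalar \<open>c \<noteq> 0\<close>, since \<open>u\<close> is invertible; rescaling by a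
  square root of \<open>c\<close>, which an algebraically closed field provides, makes the square \<open>1\<close>.
\<close>
lemma odd_involution_exists:
  assumes even: "gr 0 = range (\<lambda>c. c *s 1)" and "gr 1 \<noteq> {0}"
  shows "\<exists>e\<in>gr 1. e * e = 1"
proof -
  obtain u where u: "u \<in> gr 1" "u \<noteq> 0"
    using assms(2) subspace_0[OF subspace_gr, of 1] by auto
  have "u * u \<in> gr 0"
    using gr_mult[OF u(1) u(1)] by simp
  then obtain c where c: "u * u = c *s 1"
    using even by auto
  have "c \<noteq> 0"
    using c u homogeneous_mult_eq_0 by force
  obtain d where d: "d ^ 2 = c"
    using nth_root_exists[of 2 c] by auto
  have "d \<noteq> 0" using d \<open>c \<noteq> 0\<close> by auto
  have "(inverse d *s u) * (inverse d *s u) = (inverse d * inverse d * c) *s 1"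
    by (simp add: mult_scale_left mult_scale_right c)
  also have "inverse d * inverse d * c = 1"
    using \<open>d \<noteq> 0\<close> by (simp add: power2_eq_square field_simps flip: d)
  finally show ?thesis
    using u(1) by (intro bexI[of _ "inverse d *s u"]) (auto intro: subspace_scale subspace_gr)
qed

lemma odd_part_eq_multiples:
  assumes even: "gr 0 = range (\<lambda>c. c *s 1)" and e: "e \<in> gr 1" "e * e = 1"
  shows "gr 1 = range (\<lambda>c. c *s e)"
proof (intro equalityI subsetI)
  \<comment> \<open>The product \<open>e * y\<close> is even, hence a scalar; multiplying by \<open>e\<close> again recovers \<open>y\<close>.\<close>
  fix y assume y: "y \<in> gr 1"
  have "e * y \<in> gr 0"
    using gr_mult[OF e(1) y] by simp
  then obtain b where "e * y = b *s 1"
    using even by auto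
  then have "e * (e * y) = b *s e"
    by (simp add: mult_scale_right)
  then show "y \<in> range (\<lambda>c. c *s e)"
    by (auto simp: e(2) simp flip: mult.assoc)
qed (auto intro: subspace_scale subspace_gr e(1))

section \<open>The isomorphisms\<close>

lemma isomorphic_trivial:
  assumes even: "gr 0 = range (\<lambda>c. c *s 1)" and odd: "gr 1 = {0}"
  shows "superalgebra_isomorphic (*s) gr (*) trivial_grading"
proof -
  interpret K: gr_division_superalgebra "(*) :: 'k \<Rightarrow> 'k \<Rightarrow> 'k" trivial_grading
    by (fact gr_division_superalgebra_trivial)
  have "surj (\<lambda>c. c *s 1)"
    using gr_sum unfolding even odd by fastforce
  moreover have "Vector_Spaces.linear (*) (*s) (\<lambda>c. c *s 1)"
    by unfold_locales (auto simp: scale_left_distrib)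
  moreover have "(\<lambda>c. c *s 1) ` trivial_grading g = gr g" for g
    by (cases g) (auto simp: trivial_grading_def even odd)
  ultimately have "superalgebra_iso (*) trivial_grading (*s) gr (\<lambda>c. c *s 1)"
    by (simp add: superalgebra_iso_def bij_def inj_def mult_scale_left)
  then show ?thesis
    unfolding superalgebra_isomorphic_def using superalgebra_iso_inv by blast
qed

lemma isomorphic_D:
  assumes even: "gr 0 = range (\<lambda>c. c *s 1)" and e: "e \<in> gr 1" "e * e = 1"
  shows "superalgebra_isomorphic (*s) gr scaleD gradingD"
proof -
  interpret D: gr_division_superalgebra "scaleD :: 'k \<Rightarrow> _" gradingD
    by (fact gr_division_superalgebra_D)
  have odd: "gr 1 = range (\<lambda>c. c *s e)"
    using assms by (rule odd_part_eq_multiples)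
  \<comment> \<open>Injectivity and surjectivity of \<open>f\<close> come from the directness and the exhaustiveness of the
    grading; multiplicativity needs only \<open>e * e = 1\<close>.\<close>
  define f where "f z = D_scalar z *s 1 + D_coeff z *s e" for z
  have lin: "Vector_Spaces.linear scaleD (*s) f"
    by unfold_locales
      (auto simp: f_def scaleD_def plus_superD_def scale_left_distrib scale_right_distrib)
  interpret f: Vector_Spaces.linear scaleD "(*s)" f by (fact lin)
  have "inj f"
  proof (subst f.inj_iff_eq_0, intro allI impI)
    fix z assume "f z = 0"
    then have "D_scalar z *s 1 = (- D_coeff z) *s e"
      by (simp add: f_def add_eq_0_iff2)
    moreover have "(- D_coeff z) *s e \<in> gr 1" "D_scalar z *s 1 \<in> gr 0"
      unfolding even odd by blast+
    ultimately have "D_scalar z *s 1 = 0" "(- D_coeff z) *s e = 0"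
      using gr_direct_eq_0 by metis+
    moreover have "e \<noteq> 0" using e(2) by auto
    ultimately show "z = 0"
      by (cases z) (simp add: zero_superD_def)
  qed
  moreover have "\<exists>z. f z = x" for x
  proof -
    obtain a b where "x = a *s 1 + b *s e"
      using gr_sum[of x] unfolding even odd by auto
    then show ?thesis by (intro exI[of _ "SuperD a b"]) (simp add: f_def)
  qed
  then have "surj f" by (metis surjI)
  moreover have "f (x * y) = f x * f y" for x y
    by (simp add: f_def times_superD_def algebra_simps scale_left_distrib scale_right_distrib
        mult_scale_left mult_scale_right e(2))
  moreover have "f ` gradingD g = gr g" for g
    by (cases g) (auto simp: gradingD_def even odd f_def scaleD_def epsD_def one_superD_def
        image_image)
  moreover have "f 1 = 1"
    by (simp add: f_def one_superD_def)
  ultimately have "superalgebra_iso scaleD gradingD (*s) gr f"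
    using lin by (simp add: superalgebra_iso_def bij_def)
  then show ?thesis
    unfolding superalgebra_isomorphic_def using superalgebra_iso_inv by blast
qed

end

theorem proposition4p4:
  fixes scale :: "'k::alg_closed_field \<Rightarrow> 'a::ring_1 \<Rightarrow> 'a"
    and A :: "bit \<Rightarrow> 'a set"
  assumes "gr_division_superalgebra scale A"
    and "\<exists>Basis. finite_dimensional_vector_space scale Basis"
  shows "superalgebra_isomorphic scale A ((*) :: 'k \<Rightarrow> 'k \<Rightarrow> 'k) trivial_grading \<or>
         superalgebra_isomorphic scale A (scaleD :: 'k \<Rightarrow> 'k superD \<Rightarrow> 'k superD) gradingD"
proof -
  interpret gr_division_superalgebra scale A by (fact assms(1))
  interpret alg_closed_gr_division_superalgebra scale A ..
  obtain Basis where "finite_dimensional_vector_space scale Basis"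
    using assms(2) by blast
  then have even: "A 0 = range (\<lambda>c. scale c 1)"
    by (rule even_part_eq_scalars)
  show ?thesis
  proof (cases "A 1 = {0}")
    case True
    then show ?thesis using isomorphic_trivial even by blast
  next
    case False
    then show ?thesis using odd_involution_exists isomorphic_D even by blast
  qed
qed

end
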